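(* Let $A$ be a simple unital $C^*$-algebra, let $G$ be a finite group, and let $\alpha:G\to \mathrm{Aut}(A)$ be an action of $G$ on $A$. Then the following statements are equivalent: (1) $\alpha$ has the weak tracial Rokhlin property; (2) for every finite subset $F\subset A$, every $\varepsilon>0$ and every $x\in A_+\setminus\{0\}$, there exist mutually orthogonal positive contractions $f_g\in A$ ($g\in G$) such that, with $f=\sum_{g\in G}f_g$: (a) $\|f_ga-af_g\|<\varepsilon$ for all $g\in G$, $a\in F$; (b) $\|\alpha_g(f_h)-f_{gh}\|<\varepsilon$ for all $g,h\in G$; (c) $1-f\precsim x$; (d) $\|f\|>1-\varepsilon$; (3) for every finite subset $F\subset A$, every $\varepsilon>0$ and every $x\in A_+\setminus\{0\}$, there exist mutually orthogonal positive contractions $f_g\in A$ ($g\in G$) such that, with $f=\sum_{g\in G}f_g$: (a) $\|f_ga-af_g\|<\varepsilon$ for all $g\in G$, $a\in F$; (b) $\|\alpha_g(f_h)-f_{gh}\|<\varepsilon$ for all $g,h\in G$; (c) $1-f\precsim x$; (d) $\|faf\|>\|a\|-\varepsilon$ for all $a\in F$. Moreover, the same equivalence holds with "weak tracial Rokhlin property" replaced by "tracial Rokhlin property" and "mutually orthogonal positive contractions" replaced by "mutually orthogonal projections" in (2) and (3).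
   Context: For positive elements $a,b$ of a $C^*$-algebra $A$, $a\precsim b$ (Cuntz subequivalence) means there is a sequence $(v_n)$ in $A$ with $\|a-v_nbv_n^*\|\to 0$. An action $\alpha$ of a finite group $G$ on a simple unital $C^*$-algebra $A$ has the weak tracial Rokhlin property if for every finite subset $F\subset A$, every $\varepsilon>0$ and every $x\in A_+$ with $\|x\|=1$, there exist mutually orthogonal positive contractions $f_g\in A$ ($g\in G$), with $f=\sum_{g\in G}f_g$, such that: (a) $\|f_ga-af_g\|<\varepsilon$ for all $g\in G$, $a\in F$; (b) $\|\alpha_g(f_h)-f_{gh}\|<\varepsilon$ for all $g,h\in G$; (c) $1-f\precsim x$; (d) $\|fxf\|>1-\varepsilon$. It has the tracial Rokhlin property if the $f_g$ can moreover be chosen to be mutually orthogonal projections. *)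

theory Defs
  imports Complex_Main "HOL-Algebra.Group"
begin

text \<open>A unital C*-algebra is modelled as a type 'a of class real_normed_algebra_1 and banach
  (complete real normed unital algebra with norm 1 = 1), together with a complex scalar
  multiplication sc and an involution st satisfying the C*-identity.\<close>

definition cstar_algebra :: "('a::{real_normed_algebra_1,banach} \<Rightarrow> 'a) \<Rightarrow> (complex \<Rightarrow> 'a \<Rightarrow> 'a) \<Rightarrow> bool" where
  "cstar_algebra st sc \<longleftrightarrow>
     (\<forall>r x. sc (complex_of_real r) x = scaleR r x) \<and>
     (\<forall>c d x. sc (c + d) x = sc c x + sc d x) \<and>
     (\<forall>c x y. sc c (x + y) = sc c x + sc c y) \<and>
     (\<forall>c d x. sc (c * d) x = sc c (sc d x)) \<and>
     (\<forall>c x. norm (sc c x) = cmod c * norm x) \<and>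
     (\<forall>c x y. sc c (x * y) = sc c x * y \<and> sc c (x * y) = x * sc c y) \<and>
     (\<forall>x y. st (x + y) = st x + st y) \<and>
     (\<forall>c x. st (sc c x) = sc (cnj c) (st x)) \<and>
     (\<forall>x y. st (x * y) = st y * st x) \<and>
     (\<forall>x. st (st x) = x) \<and>
     (\<forall>x. norm (st x * x) = (norm x)\<^sup>2)"

definition cstar_ideal :: "(complex \<Rightarrow> 'a \<Rightarrow> 'a) \<Rightarrow> ('a::{real_normed_algebra_1,banach}) set \<Rightarrow> bool" where
  "cstar_ideal sc I \<longleftrightarrow> 0 \<in> I \<and> (\<forall>x\<in>I. \<forall>y\<in>I. x + y \<in> I) \<and> (\<forall>c. \<forall>x\<in>I. sc c x \<in> I) \<and>
     (\<forall>a. \<forall>x\<in>I. a * x \<in> I \<and> x * a \<in> I)"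

definition simple_unital_cstar_algebra :: "('a::{real_normed_algebra_1,banach} \<Rightarrow> 'a) \<Rightarrow> (complex \<Rightarrow> 'a \<Rightarrow> 'a) \<Rightarrow> bool" where
  "simple_unital_cstar_algebra st sc \<longleftrightarrow> cstar_algebra st sc \<and>
     (\<forall>I. cstar_ideal sc I \<and> closed I \<longrightarrow> I = {0} \<or> I = UNIV)"

definition positive :: "('a::{real_normed_algebra_1,banach} \<Rightarrow> 'a) \<Rightarrow> 'a \<Rightarrow> bool" where
  "positive st a \<longleftrightarrow> (\<exists>b. a = st b * b)"

definition pos_contraction :: "('a::{real_normed_algebra_1,banach} \<Rightarrow> 'a) \<Rightarrow> 'a \<Rightarrow> bool" where
  "pos_contraction st a \<longleftrightarrow> positive st a \<and> norm a \<le> 1"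

definition projection :: "('a::{real_normed_algebra_1,banach} \<Rightarrow> 'a) \<Rightarrow> 'a \<Rightarrow> bool" where
  "projection st p \<longleftrightarrow> st p = p \<and> p * p = p"

definition cuntz_below :: "('a::{real_normed_algebra_1,banach} \<Rightarrow> 'a) \<Rightarrow> 'a \<Rightarrow> 'a \<Rightarrow> bool" where
  "cuntz_below st a b \<longleftrightarrow> (\<exists>v :: nat \<Rightarrow> 'a. (\<lambda>n. v n * b * st (v n)) \<longlonglongrightarrow> a)"

definition star_automorphism :: "('a::{real_normed_algebra_1,banach} \<Rightarrow> 'a) \<Rightarrow> (complex \<Rightarrow> 'a \<Rightarrow> 'a) \<Rightarrow> ('a \<Rightarrow> 'a) \<Rightarrow> bool" where
  "star_automorphism st sc \<phi> \<longleftrightarrow> bij \<phi> \<and> (\<forall>x y. \<phi> (x + y) = \<phi> x + \<phi> y) \<and>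
     (\<forall>c x. \<phi> (sc c x) = sc c (\<phi> x)) \<and> (\<forall>x y. \<phi> (x * y) = \<phi> x * \<phi> y) \<and>
     (\<forall>x. \<phi> (st x) = st (\<phi> x))"

definition group_action_cstar :: "('g, 'b) monoid_scheme \<Rightarrow> ('a::{real_normed_algebra_1,banach} \<Rightarrow> 'a) \<Rightarrow> (complex \<Rightarrow> 'a \<Rightarrow> 'a) \<Rightarrow> ('g \<Rightarrow> 'a \<Rightarrow> 'a) \<Rightarrow> bool" where
  "group_action_cstar G st sc \<alpha> \<longleftrightarrow> (\<forall>g\<in>carrier G. star_automorphism st sc (\<alpha> g)) \<and>
     \<alpha> \<one>\<^bsub>G\<^esub> = id \<and> (\<forall>g\<in>carrier G. \<forall>h\<in>carrier G. \<alpha> (g \<otimes>\<^bsub>G\<^esub> h) = \<alpha> g \<circ> \<alpha> h)"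

text \<open>Conditions (a), (b), (c) together with mutual orthogonality; P says what kind of element
  each f_g is (positive contraction or projection).\<close>
definition rokhlin_tower :: "('g, 'b) monoid_scheme \<Rightarrow> ('a::{real_normed_algebra_1,banach} \<Rightarrow> 'a) \<Rightarrow> ('g \<Rightarrow> 'a \<Rightarrow> 'a)
     \<Rightarrow> ('a \<Rightarrow> bool) \<Rightarrow> 'a set \<Rightarrow> real \<Rightarrow> 'a \<Rightarrow> ('g \<Rightarrow> 'a) \<Rightarrow> bool" where
  "rokhlin_tower G st \<alpha> P F \<epsilon> x f \<longleftrightarrow>
     (\<forall>g\<in>carrier G. P (f g)) \<and>
     (\<forall>g\<in>carrier G. \<forall>h\<in>carrier G. g \<noteq> h \<longrightarrow> f g * f h = 0) \<and>
     (\<forall>g\<in>carrier G. \<forall>a\<in>F. norm (f g * a - a * f g) < \<epsilon>) \<and>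
     (\<forall>g\<in>carrier G. \<forall>h\<in>carrier G. norm (\<alpha> g (f h) - f (g \<otimes>\<^bsub>G\<^esub> h)) < \<epsilon>) \<and>
     cuntz_below st (1 - (\<Sum>g\<in>carrier G. f g)) x"

definition rokhlin_type_property :: "('g, 'b) monoid_scheme \<Rightarrow> ('a::{real_normed_algebra_1,banach} \<Rightarrow> 'a) \<Rightarrow> ('g \<Rightarrow> 'a \<Rightarrow> 'a)
     \<Rightarrow> ('a \<Rightarrow> bool) \<Rightarrow> bool" where
  "rokhlin_type_property G st \<alpha> P \<longleftrightarrow>
     (\<forall>F \<epsilon> x. finite F \<and> \<epsilon> > 0 \<and> positive st x \<and> norm x = 1 \<longrightarrow>
        (\<exists>f. rokhlin_tower G st \<alpha> P F \<epsilon> x f \<and>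
             norm ((\<Sum>g\<in>carrier G. f g) * x * (\<Sum>g\<in>carrier G. f g)) > 1 - \<epsilon>))"

definition weak_tracial_rokhlin :: "('g, 'b) monoid_scheme \<Rightarrow> ('a::{real_normed_algebra_1,banach} \<Rightarrow> 'a) \<Rightarrow> ('g \<Rightarrow> 'a \<Rightarrow> 'a) \<Rightarrow> bool" where
  "weak_tracial_rokhlin G st \<alpha> \<longleftrightarrow> rokhlin_type_property G st \<alpha> (pos_contraction st)"

definition tracial_rokhlin :: "('g, 'b) monoid_scheme \<Rightarrow> ('a::{real_normed_algebra_1,banach} \<Rightarrow> 'a) \<Rightarrow> ('g \<Rightarrow> 'a \<Rightarrow> 'a) \<Rightarrow> bool" where
  "tracial_rokhlin G st \<alpha> \<longleftrightarrow> rokhlin_type_property G st \<alpha> (projection st)"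

definition rokhlin_cond2 :: "('g, 'b) monoid_scheme \<Rightarrow> ('a::{real_normed_algebra_1,banach} \<Rightarrow> 'a) \<Rightarrow> ('g \<Rightarrow> 'a \<Rightarrow> 'a)
     \<Rightarrow> ('a \<Rightarrow> bool) \<Rightarrow> bool" where
  "rokhlin_cond2 G st \<alpha> P \<longleftrightarrow>
     (\<forall>F \<epsilon> x. finite F \<and> \<epsilon> > 0 \<and> positive st x \<and> x \<noteq> 0 \<longrightarrow>
        (\<exists>f. rokhlin_tower G st \<alpha> P F \<epsilon> x f \<and> norm (\<Sum>g\<in>carrier G. f g) > 1 - \<epsilon>))"

definition rokhlin_cond3 :: "('g, 'b) monoid_scheme \<Rightarrow> ('a::{real_normed_algebra_1,banach} \<Rightarrow> 'a) \<Rightarrow> ('g \<Rightarrow> 'a \<Rightarrow> 'a)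
     \<Rightarrow> ('a \<Rightarrow> bool) \<Rightarrow> bool" where
  "rokhlin_cond3 G st \<alpha> P \<longleftrightarrow>
     (\<forall>F \<epsilon> x. finite F \<and> \<epsilon> > 0 \<and> positive st x \<and> x \<noteq> 0 \<longrightarrow>
        (\<exists>f. rokhlin_tower G st \<alpha> P F \<epsilon> x f \<and>
             (\<forall>a\<in>F. norm ((\<Sum>g\<in>carrier G. f g) * a * (\<Sum>g\<in>carrier G. f g)) > norm a - \<epsilon>)))"

end

theory Submission
  imports Defs "HOL-Computational_Algebra.Formal_Power_Series"
begin

text \<open>Only the passage from the condition on the norm of \<open>f\<close> to the condition on the norms of
  \<open>f a f\<close> has content. Self-adjoint contractions \<open>f\<close> that are asymptotically central and have norm
  tending to 1 along a filter define a seminorm as the infimum over \<open>k\<close> of the limsup of the norms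
  of \<open>f^k b\<close>; asymptotic centrality makes it a C*-seminorm, and it is 1 at the unit. Its null space
  is a closed ideal, so by simplicity it is a C*-norm, and a C*-norm below the given complete one
  agrees with it. Hence the norm of \<open>f a f\<close> cannot stay below that of \<open>a\<close>.

  The uniqueness of the C*-norm needs square roots only, and these are given by the binomial series
  of \<open>(1 - z)^(1/2)\<close>, which converges absolutely on the closed unit ball of a Banach algebra.\<close>

section \<open>Square roots in Banach algebras\<close>

definition sqrt_coeff :: "nat \<Rightarrow> real" where
  "sqrt_coeff n = ((1/2) gchoose n) * (-1) ^ n"

lemma sqrt_coeff_0 [simp]: "sqrt_coeff 0 = 1"
  by (simp add: sqrt_coeff_def)

lemma gbinomial_Suc_ratio:
  fixes a :: real
  shows "a gchoose (Suc n) = (a gchoose n) * (a - real n) / real (Suc n)"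
  by (simp add: gbinomial_prod_rev)

text \<open>The ratio of consecutive coefficients is \<open>(n - 1/2) / (n + 1)\<close>, negative
  only for \<open>n = 0\<close>, so the sign changes once, right after the leading 1.\<close>

lemma sqrt_coeff_nonpos: "n > 0 \<Longrightarrow> sqrt_coeff n \<le> 0"
proof (induction n)
  case (Suc n)
  have rec: "sqrt_coeff (Suc n) = sqrt_coeff n * ((real n - 1/2) / real (Suc n))"
    unfolding sqrt_coeff_def gbinomial_Suc_ratio by (simp add: field_simps)
  show ?case
  proof (cases "n = 0")
    case True
    then show ?thesis using rec by simp
  next
    case False
    then have "sqrt_coeff n \<le> 0" "(real n - 1/2) / real (Suc n) \<ge> 0"
      using Suc.IH by auto
    then show ?thesis unfolding rec by (rule mult_nonpos_nonneg)
  qed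
qed simp

text \<open>Dividing a series by \<open>1 - z\<close> turns its coefficients into partial sums, so
  these are the coefficients of \<open>(1 - z)^(-1/2)\<close>, all nonnegative.\<close>

lemma sqrt_coeff_sum_nonneg: "(\<Sum>n\<le>m. sqrt_coeff n) \<ge> 0"
proof -
  have "(-1) ^ m * ((-1/2 :: real) gchoose m) \<ge> 0"
  proof (induction m)
    case (Suc m)
    have "(-1) ^ Suc m * ((-1/2 :: real) gchoose Suc m)
        = ((-1) ^ m * ((-1/2) gchoose m)) * ((real m + 1/2) / real (Suc m))"
      unfolding gbinomial_Suc_ratio by (simp add: field_simps)
    then show ?case using Suc by simp
  qed simp
  then show ?thesis
    unfolding sqrt_coeff_def gbinomial_sum_lower_neg by simp
qed

text \<open>The coefficients involved share one sign, so their absolute values add up to 1 minus a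
  partial sum of the full series. Hence the series converges absolutely up to the boundary of the
  unit ball.\<close>

lemma sum_abs_sqrt_coeff_le: "(\<Sum>n<m. \<bar>sqrt_coeff (Suc n)\<bar>) \<le> 1"
proof -
  have "(\<Sum>n<m. \<bar>sqrt_coeff (Suc n)\<bar>) = - (\<Sum>n<m. sqrt_coeff (Suc n))"
    unfolding sum_negf [symmetric] by (intro sum.cong) (simp_all add: sqrt_coeff_nonpos)
  also have "\<dots> = 1 - (\<Sum>n<Suc m. sqrt_coeff n)"
    by (subst sum.lessThan_Suc_shift) simp
  also have "\<dots> \<le> 1"
    using sqrt_coeff_sum_nonneg [of m] by (simp add: lessThan_Suc_atMost)
  finally show ?thesis .
qed

lemma summable_abs_sqrt_coeff: "summable (\<lambda>n. \<bar>sqrt_coeff (Suc n)\<bar>)"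
  by (intro summableI_nonneg_bounded [where x = 1]) (simp_all add: sum_abs_sqrt_coeff_le)

lemma suminf_abs_sqrt_coeff_le: "(\<Sum>n. \<bar>sqrt_coeff (Suc n)\<bar>) \<le> 1"
  by (intro suminf_le_const summable_abs_sqrt_coeff sum_abs_sqrt_coeff_le)

text \<open>Vandermonde's identity with \<open>1/2 + 1/2 = 1\<close>: the square of the series is
  \<open>1 - z\<close>.\<close>

lemma sqrt_coeff_convolution:
  "(\<Sum>i\<le>n. sqrt_coeff i * sqrt_coeff (n - i)) = (if n = 0 then 1 else if n = 1 then -1 else 0)"
proof -
  have "(\<Sum>i\<le>n. sqrt_coeff i * sqrt_coeff (n - i))
      = (\<Sum>i\<le>n. ((1/2) gchoose i) * ((1/2) gchoose (n - i))) * (-1) ^ n"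
    unfolding sum_distrib_right sqrt_coeff_def
    by (intro sum.cong) (simp_all add: power_add [symmetric] mult_ac)
  also have "\<dots> = (of_nat 1 gchoose n) * (-1) ^ n"
    by (simp add: atMost_atLeast0 gbinomial_Vandermonde)
  also have "\<dots> = of_nat (1 choose n) * (-1) ^ n"
    by (simp only: binomial_gbinomial)
  also have "\<dots> = (if n = 0 then 1 else if n = 1 then -1 else 0)"
    by (cases n; cases "n - 1") auto
  finally show ?thesis .
qed

section \<open>The square root on the closed unit ball around 1\<close>

definition banach_sqrt :: "'a::{real_normed_algebra_1,banach} \<Rightarrow> 'a" where
  "banach_sqrt x = (\<Sum>n. sqrt_coeff n *\<^sub>R (1 - x) ^ n)"

context
  fixes x :: "'a::{real_normed_algebra_1,banach}"
  assumes ball: "norm (1 - x) \<le> 1"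
begin

lemma norm_sqrt_term_le: "norm (sqrt_coeff n *\<^sub>R (1 - x) ^ n) \<le> \<bar>sqrt_coeff n\<bar>"
proof -
  have "norm ((1 - x) ^ n) \<le> 1"
    by (rule order_trans [OF norm_power_ineq]) (simp add: power_le_one ball)
  then show ?thesis
    by (simp add: mult_left_le)
qed

lemma summable_norm_sqrt_term: "summable (\<lambda>n. norm (sqrt_coeff n *\<^sub>R (1 - x) ^ n))"
proof -
  have "summable (\<lambda>n. norm (sqrt_coeff (Suc n) *\<^sub>R (1 - x) ^ Suc n))"
    by (rule summable_comparison_test' [OF summable_abs_sqrt_coeff, of 0])
       (simp only: real_norm_def abs_norm_cancel norm_sqrt_term_le)
  then show ?thesis by (subst summable_Suc_iff [symmetric])
qed

lemmas summable_sqrt_term = summable_norm_cancel [OF summable_norm_sqrt_term]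

lemma banach_sqrt_square: "banach_sqrt x * banach_sqrt x = x"
proof -
  let ?z = "1 - x"
  have "banach_sqrt x * banach_sqrt x
      = (\<Sum>n. \<Sum>i\<le>n. (sqrt_coeff i *\<^sub>R ?z ^ i) * (sqrt_coeff (n - i) *\<^sub>R ?z ^ (n - i)))"
    unfolding banach_sqrt_def
    by (rule Cauchy_product [OF summable_norm_sqrt_term summable_norm_sqrt_term])
  also have "\<dots> = (\<Sum>n. (if n = 0 then 1 else if n = 1 then -1 else 0) *\<^sub>R ?z ^ n)"
  proof -
    have "(\<Sum>i\<le>n. (sqrt_coeff i *\<^sub>R ?z ^ i) * (sqrt_coeff (n - i) *\<^sub>R ?z ^ (n - i)))
        = (\<Sum>i\<le>n. sqrt_coeff i * sqrt_coeff (n - i)) *\<^sub>R ?z ^ n" for n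
      unfolding scaleR_sum_left
      by (intro sum.cong) (simp_all add: power_add [symmetric])
    then show ?thesis by (simp only: sqrt_coeff_convolution)
  qed
  also have "\<dots> = (\<Sum>n\<in>{0, 1}. (if n = 0 then 1 else if n = 1 then -1 else 0) *\<^sub>R ?z ^ n)"
    by (rule suminf_finite) auto
  also have "\<dots> = x" by simp
  finally show ?thesis .
qed

text \<open>The constant term cancels and the remaining coefficients have absolute sum at most 1.
  The root thus stays in the ball where the series converges, so a further root can be
  taken.\<close>

lemma norm_one_minus_banach_sqrt_le: "norm (1 - banach_sqrt x) \<le> 1"
proof -
  have "banach_sqrt x = 1 + (\<Sum>n. sqrt_coeff (Suc n) *\<^sub>R (1 - x) ^ Suc n)"
    unfolding banach_sqrt_def using suminf_split_head [OF summable_sqrt_term] by simp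
  then have "norm (1 - banach_sqrt x) = norm (\<Sum>n. sqrt_coeff (Suc n) *\<^sub>R (1 - x) ^ Suc n)"
    by (simp del: power_Suc)
  also have "\<dots> \<le> (\<Sum>n. \<bar>sqrt_coeff (Suc n)\<bar>)"
    by (rule norm_suminf_le [OF norm_sqrt_term_le summable_abs_sqrt_coeff])
  also have "\<dots> \<le> 1" by (rule suminf_abs_sqrt_coeff_le)
  finally show ?thesis .
qed

lemma banach_sqrt_commute:
  assumes "y * x = x * y"
  shows "y * banach_sqrt x = banach_sqrt x * y"
proof -
  have "y * (1 - x) ^ n = (1 - x) ^ n * y" for n
    by (rule power_commuting_commutes [symmetric]) (simp add: algebra_simps assms)
  then show ?thesis
    unfolding banach_sqrt_def
    by (simp add: suminf_mult [OF summable_sqrt_term, symmetric]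
        suminf_mult2 [OF summable_sqrt_term])
qed

end

section \<open>C*-algebras\<close>

locale cstar =
  fixes st :: "'a::{real_normed_algebra_1,banach} \<Rightarrow> 'a" and sc :: "complex \<Rightarrow> 'a \<Rightarrow> 'a"
  assumes cstar_algebra: "cstar_algebra st sc"
begin

lemma sc_of_real: "sc (complex_of_real r) x = r *\<^sub>R x"
  and sc_sc: "sc (c * d) x = sc c (sc d x)"
  and norm_sc: "norm (sc c x) = cmod c * norm x"
  and sc_mult_left: "sc c (x * y) = sc c x * y"
  and sc_mult_right: "sc c (x * y) = x * sc c y"
  and st_add: "st (x + y) = st x + st y"
  and st_sc: "st (sc c x) = sc (cnj c) (st x)"
  and st_mult: "st (x * y) = st y * st x"
  and st_st [simp]: "st (st x) = x"
  and norm_st_mult_self: "norm (st x * x) = (norm x)\<^sup>2"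
  using cstar_algebra unfolding cstar_algebra_def by metis+

lemma st_scaleR: "st (r *\<^sub>R x) = r *\<^sub>R st x"
  by (metis complex_cnj_complex_of_real sc_of_real st_sc)

lemma st_one [simp]: "st 1 = 1"
  by (metis mult_1 st_mult st_st)

lemma norm_st [simp]: "norm (st x) = norm x"
proof -
  have le: "norm y \<le> norm (st y)" for y
  proof (cases "y = 0")
    case False
    have "norm y * norm y \<le> norm (st y) * norm y"
      by (metis norm_mult_ineq norm_st_mult_self power2_eq_square)
    then show ?thesis using False by simp
  qed simp
  show ?thesis using le [of x] le [of "st x"] by simp
qed

lemma bounded_linear_st: "bounded_linear st"
  by (rule bounded_linear_intro [where K = 1]) (simp_all add: st_add st_scaleR)

lemmas st_zero [simp] = linear_0 [OF bounded_linear.linear [OF bounded_linear_st]]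
lemmas st_diff = linear_diff [OF bounded_linear.linear [OF bounded_linear_st]]
lemmas st_sum = linear_sum [OF bounded_linear.linear [OF bounded_linear_st]]

lemma st_power: "st (x ^ n) = st x ^ n"
  by (induction n) (simp_all add: st_mult power_commutes)

lemma st_banach_sqrt:
  assumes "norm (1 - x) \<le> 1" "st x = x"
  shows "st (banach_sqrt x) = banach_sqrt x"
  unfolding banach_sqrt_def
  by (subst bounded_linear.suminf [OF bounded_linear_st summable_sqrt_term [OF assms(1)]])
     (simp add: st_scaleR st_power st_diff assms(2))

lemma norm_selfadjoint_square: "st x = x \<Longrightarrow> norm (x * x) = (norm x)\<^sup>2"
  using norm_st_mult_self [of x] by simp

text \<open>Each use of the C*-identity doubles the exponent, hence powers of two.\<close>

lemma norm_selfadjoint_power: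
  assumes "st x = x"
  shows "norm (x ^ (2 ^ m)) = norm x ^ (2 ^ m)"
proof (induction m)
  case (Suc m)
  have "norm (x ^ (2 ^ Suc m)) = norm (x ^ (2 ^ m) * x ^ (2 ^ m))"
    by (simp add: power_add [symmetric] mult_2)
  also have "\<dots> = (norm (x ^ (2 ^ m)))\<^sup>2"
    by (rule norm_selfadjoint_square) (simp add: st_power assms)
  also have "\<dots> = norm x ^ (2 ^ Suc m)"
    unfolding Suc by (simp add: power_mult [symmetric] mult.commute)
  finally show ?case .
qed simp

text \<open>The scalar i as a central, skew-adjoint element, so that Cartesian decompositions can be
  computed inside the ring.\<close>

definition imag_unit :: 'a where "imag_unit = sc \<i> 1"

lemma imag_unit_square: "imag_unit * imag_unit = -1"
proof -
  have "imag_unit * imag_unit = sc (\<i> * \<i>) 1"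
    unfolding imag_unit_def sc_mult_left [symmetric] sc_mult_right [symmetric]
    by (simp only: mult_1 sc_sc)
  also have "\<dots> = sc (complex_of_real (-1)) 1" by simp
  finally show ?thesis unfolding sc_of_real by simp
qed

lemma imag_unit_commute: "x * imag_unit = imag_unit * x"
  unfolding imag_unit_def sc_mult_left [symmetric] sc_mult_right [symmetric] by simp

lemma st_imag_unit: "st imag_unit = - imag_unit"
proof -
  have "st imag_unit = sc (complex_of_real (-1) * \<i>) 1"
    unfolding imag_unit_def st_sc by simp
  also have "\<dots> = - imag_unit"
    unfolding sc_sc sc_of_real imag_unit_def by simp
  finally show ?thesis .
qed

lemma st_mult_self_cartesian:
  assumes "st a = a" "st b = b" "a * b = b * a"
  shows "st (a + imag_unit * b) * (a + imag_unit * b) = a * a + b * b"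
proof -
  have st: "st (a + imag_unit * b) = a - imag_unit * b"
    by (simp add: st_add st_mult assms st_imag_unit imag_unit_commute)
  have 1: "a * (imag_unit * b) = imag_unit * (b * a)"
    by (metis assms(3) imag_unit_commute mult.assoc)
  have 2: "imag_unit * b * (imag_unit * b) = - (b * b)"
    by (metis imag_unit_commute imag_unit_square mult.assoc mult_minus1)
  show ?thesis
    unfolding st by (simp add: algebra_simps 1 2 [unfolded mult.assoc])
qed

section \<open>C*-seminorms and uniqueness of the C*-norm\<close>

definition cstar_seminorm :: "('a \<Rightarrow> real) \<Rightarrow> bool" where
  "cstar_seminorm N \<longleftrightarrow>
     (\<forall>x. 0 \<le> N x \<and> N x \<le> norm x) \<and>
     (\<forall>x y. N (x + y) \<le> N x + N y) \<and>
     (\<forall>x y. N (x * y) \<le> N x * N y) \<and>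
     (\<forall>x. (N x)\<^sup>2 \<le> N (st x * x))"

lemma cstar_seminorm_norm: "cstar_seminorm norm"
  unfolding cstar_seminorm_def
  by (simp add: norm_triangle_ineq norm_mult_ineq norm_st_mult_self)

context
  fixes N :: "'a \<Rightarrow> real"
  assumes N: "cstar_seminorm N"
begin

lemma seminorm_nonneg: "0 \<le> N x"
  and seminorm_le_norm: "N x \<le> norm x"
  and seminorm_add: "N (x + y) \<le> N x + N y"
  and seminorm_mult: "N (x * y) \<le> N x * N y"
  and seminorm_cstar: "(N x)\<^sup>2 \<le> N (st x * x)"
  using N unfolding cstar_seminorm_def by blast+

text \<open>Scaling is multiplication by \<open>sc c 1\<close>, so this half of homogeneity follows
  from submultiplicativity and domination by the norm.\<close>

lemma seminorm_sc: "N (sc c x) \<le> cmod c * N x"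
proof -
  have "N (sc c x) = N (sc c 1 * x)" by (simp add: sc_mult_left [symmetric])
  also have "\<dots> \<le> N (sc c 1) * N x" by (rule seminorm_mult)
  also have "\<dots> \<le> cmod c * N x"
    using seminorm_le_norm [of "sc c 1"] seminorm_nonneg [of x]
    by (intro mult_right_mono) (simp_all add: norm_sc)
  finally show ?thesis .
qed

lemma seminorm_scaleR: "N (r *\<^sub>R x) \<le> \<bar>r\<bar> * N x"
  using seminorm_sc [of "complex_of_real r" x] by (simp add: sc_of_real)

text \<open>The C*-inequality for \<open>st x\<close> and submultiplicativity leave a common factor
  \<open>N (st x)\<close> to cancel.\<close>

lemma seminorm_st: "N (st x) \<le> N x"
proof (cases "N (st x) = 0")
  case False
  then have pos: "N (st x) > 0" using seminorm_nonneg [of "st x"] by simp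
  have "N (st x) * N (st x) \<le> N x * N (st x)"
    using seminorm_cstar [of "st x"] seminorm_mult [of x "st x"] by (simp add: power2_eq_square)
  then show ?thesis using pos by simp
qed (simp add: seminorm_nonneg)

text \<open>Here \<open>a\<close> is the real part of \<open>a + imag_unit * b\<close>, hence the
  average of that element and its adjoint. The inequality takes the place of monotonicity of
  \<open>N\<close> on positive elements.\<close>

lemma seminorm_real_part:
  assumes "st a = a" "st b = b" "a * b = b * a"
  shows "(N a)\<^sup>2 \<le> N (a * a + b * b)"
proof -
  let ?z = "a + imag_unit * b"
  have "st ?z = a - imag_unit * b"
    by (simp add: st_add st_mult assms st_imag_unit imag_unit_commute)
  then have "a = (1/2) *\<^sub>R (?z + st ?z)"
    by (simp add: scaleR_2 [symmetric])
  then have "N a \<le> 1/2 * N (?z + st ?z)"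
    using seminorm_scaleR [of "1/2" "?z + st ?z"] by simp
  also have "\<dots> \<le> N ?z"
    using seminorm_add [of ?z "st ?z"] seminorm_st [of ?z] by simp
  finally have "(N a)\<^sup>2 \<le> (N ?z)\<^sup>2"
    by (intro power_mono seminorm_nonneg)
  also have "\<dots> \<le> N (a * a + b * b)"
    using seminorm_cstar [of ?z] st_mult_self_cartesian [OF assms] by simp
  finally show ?thesis .
qed

end

text \<open>The unitary \<open>u = y + i sqrt (1 - y\<^sup>2)\<close> has real part \<open>y\<close>, and
  \<open>1 - y\<^sup>2\<close> is the average of \<open>1\<close>, \<open>1\<close>, \<open>- u\<^sup>2\<close> and \<open>- u\<^sup>*\<^sup>2\<close>.\<close>
lemma norm_one_minus_square_le:
  assumes "st y = y" "norm y \<le> 1"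
  shows "norm (1 - y * y) \<le> 1"
proof -
  have ball: "norm (1 - (1 - y * y)) \<le> 1"
    using assms by (simp add: norm_selfadjoint_square power_le_one)
  define r where "r = banach_sqrt (1 - y * y)"
  have rr: "r * r = 1 - y * y" unfolding r_def by (rule banach_sqrt_square [OF ball])
  have st_r: "st r = r"
    unfolding r_def by (rule st_banach_sqrt [OF ball]) (simp add: st_diff st_mult assms)
  have yr: "y * r = r * y"
    unfolding r_def by (rule banach_sqrt_commute [OF ball]) (simp add: algebra_simps)
  define u where "u = y + imag_unit * r"
  have "st u * u = 1"
    unfolding u_def using st_mult_self_cartesian [OF assms(1) st_r yr] rr by simp
  then have "(norm u)\<^sup>2 = 1" using norm_st_mult_self [of u] by simp
  then have u1: "norm u = 1" using power2_eq_1_iff [of "norm u"] norm_ge_zero [of u] by linarith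
  have uu: "norm (u * u) \<le> 1" "norm (st u * st u) \<le> 1"
    using norm_mult_ineq [of u u] norm_mult_ineq [of "st u" "st u"] u1 by simp_all
  have st_u: "st u = y - imag_unit * r"
    unfolding u_def by (simp add: st_add st_mult assms st_r st_imag_unit imag_unit_commute)
  have irir: "imag_unit * r * (imag_unit * r) = - (r * r)"
    by (metis imag_unit_commute imag_unit_square mult.assoc mult_minus1)
  have "u * u + st u * st u = 2 *\<^sub>R (y * y) + 2 *\<^sub>R (imag_unit * r * (imag_unit * r))"
    unfolding st_u unfolding u_def by (simp add: algebra_simps scaleR_2)
  also have "\<dots> = 4 *\<^sub>R (y * y) - 2 *\<^sub>R 1"
    unfolding irir rr by (simp add: scaleR_diff_right flip: scaleR_add_left)
  finally have *: "u * u + st u * st u = 4 *\<^sub>R (y * y) - 2 *\<^sub>R 1" .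
  have "4 *\<^sub>R (1 - y * y) = 2 *\<^sub>R 1 - (4 *\<^sub>R (y * y) - 2 *\<^sub>R 1)"
    by (simp add: scaleR_diff_right flip: scaleR_add_left)
  also have "\<dots> = 2 *\<^sub>R 1 - u * u - st u * st u"
    unfolding * [symmetric] by simp
  finally have "4 *\<^sub>R (1 - y * y) = 2 *\<^sub>R 1 - u * u - st u * st u" .
  then have "4 * norm (1 - y * y) = norm (2 *\<^sub>R 1 - u * u - st u * st u)"
    by (metis norm_scaleR abs_numeral)
  also have "\<dots> \<le> norm (2 *\<^sub>R (1::'a)) + norm (u * u) + norm (st u * st u)"
    using norm_triangle_ineq4 [of "2 *\<^sub>R 1 - u * u" "st u * st u"]
      norm_triangle_ineq4 [of "2 *\<^sub>R 1" "u * u"] by linarith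
  also have "\<dots> \<le> 4" using uu by simp
  finally show ?thesis by simp
qed

text \<open>The element \<open>p\<close> is the positive part of \<open>y\<^sup>2 - t\<close>, and \<open>p\<^sup>3 = (p q)\<^sup>2\<close> for
  a square root \<open>q\<close> of the absolute value of \<open>y\<^sup>2 - t\<close>.\<close>
lemma spectral_bump:
  assumes y: "st y = y" "norm y = 1" and t: "0 \<le> t" "t < 1"
  obtains p q where "p \<noteq> 0" "st p = p" "st q = q" "p * q = q * p"
    "y * y * (p * p) = t *\<^sub>R (p * p) + p * q * (p * q)"
proof -
  define k where "k = y * y - t *\<^sub>R 1"
  have st_k: "st k = k" by (simp add: k_def st_diff st_mult y st_scaleR)
  \<comment> \<open>Weights \<open>1 - t\<close> and \<open>t\<close> on two contractions show that
    \<open>k\<close> is a contraction, so \<open>k * k\<close> lies in the ball where square roots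
    exist.\<close>
  have "k = (1 - t) *\<^sub>R (y * y) - t *\<^sub>R (1 - y * y)"
    by (simp add: k_def algebra_simps)
  then have "norm k \<le> norm ((1 - t) *\<^sub>R (y * y)) + norm (t *\<^sub>R (1 - y * y))"
    by (simp only: norm_triangle_ineq4)
  also have "\<dots> \<le> (1 - t) * 1 + t * 1"
    unfolding norm_scaleR using t y norm_one_minus_square_le [of y]
    by (intro add_mono mult_mono) (simp_all add: norm_selfadjoint_square)
  finally have "norm k \<le> 1" by simp
  note k_ball = norm_one_minus_square_le [OF st_k this]
  \<comment> \<open>\<open>m\<close> is the absolute value of \<open>k\<close>, \<open>q\<close> its
    square root, and \<open>p\<close> the positive part of \<open>k\<close>.\<close>
  define m where "m = banach_sqrt (k * k)"
  have mm: "m * m = k * k" unfolding m_def by (rule banach_sqrt_square [OF k_ball])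
  have st_m: "st m = m"
    unfolding m_def by (rule st_banach_sqrt [OF k_ball]) (simp add: st_mult st_k)
  have m_comm: "z * m = m * z" if "z * k = k * z" for z
    unfolding m_def by (rule banach_sqrt_commute [OF k_ball]) (metis that mult.assoc)
  have m_ball: "norm (1 - m) \<le> 1"
    unfolding m_def by (rule norm_one_minus_banach_sqrt_le [OF k_ball])
  define q where "q = banach_sqrt m"
  have qq: "q * q = m" unfolding q_def by (rule banach_sqrt_square [OF m_ball])
  have st_q: "st q = q" unfolding q_def by (rule st_banach_sqrt [OF m_ball st_m])
  have q_comm: "z * q = q * z" if "z * k = k * z" for z
    unfolding q_def by (rule banach_sqrt_commute [OF m_ball m_comm [OF that]])
  define p where "p = (1/2) *\<^sub>R (m + k)"
  have km: "k * m = m * k" by (rule m_comm) simp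
  have pk: "p * k = k * p" by (simp add: p_def algebra_simps km)
  \<comment> \<open>On its positive part, \<open>k\<close> agrees with both its absolute value and
    \<open>p\<close>.\<close>
  have p_sq: "p * p = p * k" "p * p = p * m"
    by (simp_all add: p_def algebra_simps km mm flip: scaleR_add_left)
  have yk: "y * k = k * y" by (simp add: k_def algebra_simps)
  have "p \<noteq> 0"
  proof
    \<comment> \<open>Then \<open>k = - (q * q)\<close>, so \<open>y * y + q * q\<close> is the
      scalar \<open>t\<close>, and the real part inequality for the norm itself contradicts
      \<open>norm y = 1\<close>.\<close>
    assume "p = 0"
    then have "q * q + k = 0" by (simp add: p_def qq)
    then have "y * y + q * q = t *\<^sub>R 1" by (simp add: k_def algebra_simps)
    then have "(norm y)\<^sup>2 \<le> t"
      using seminorm_real_part [OF cstar_seminorm_norm y(1) st_q q_comm [OF yk]] t by simp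
    then show False using y t by simp
  qed
  moreover have "st p = p" by (simp add: p_def st_scaleR st_add st_m st_k)
  moreover have "st q = q" by fact
  moreover have pq: "p * q = q * p" by (rule q_comm [OF pk])
  moreover have "y * y * (p * p) = t *\<^sub>R (p * p) + p * q * (p * q)"
  proof -
    have "p * q * (p * q) = p * p * (q * q)" by (metis pq mult.assoc)
    also have "\<dots> = p * (p * m)" by (simp add: qq mult.assoc)
    also have "\<dots> = k * (p * p)" by (metis p_sq pk mult.assoc)
    finally show ?thesis by (simp add: k_def algebra_simps)
  qed
  ultimately show thesis by (rule that)
qed

text \<open>For \<open>y\<close> the normalised \<open>st a * a\<close> and \<open>t < 1\<close>,
  multiplying \<open>y * y\<close> by the square of a bump \<open>p\<close> gives at least
  \<open>t\<close> times that square. The real part inequality turns this into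
  \<open>t * (N p)^2 \<le> N (y * y) * (N p)^2\<close>; injectivity allows cancelling
  \<open>N p\<close>, and letting \<open>t\<close> tend to 1 gives
  \<open>N (y * y) \<ge> 1\<close>.\<close>

lemma cstar_norm_unique:
  assumes N: "cstar_seminorm N" and inj: "\<And>x. N x = 0 \<Longrightarrow> x = 0"
  shows "N a = norm a"
proof (cases "a = 0")
  case True
  then show ?thesis
    using seminorm_nonneg [OF N, of a] seminorm_le_norm [OF N, of a] by simp
next
  case False
  define s where "s = (norm a)\<^sup>2"
  have s: "s > 0" using False by (simp add: s_def)
  define y where "y = (1 / s) *\<^sub>R (st a * a)"
  have st_y: "st y = y" by (simp add: y_def st_scaleR st_mult)
  have norm_y: "norm y = 1" using s by (simp add: y_def norm_st_mult_self s_def)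
  have bound: "t \<le> N (y * y)" if t01: "0 \<le> t" "t < 1" for t
  proof -
    obtain p q where pq: "p \<noteq> 0" "st p = p" "st q = q" "p * q = q * p"
      "y * y * (p * p) = t *\<^sub>R (p * p) + p * q * (p * q)"
      by (rule spectral_bump [OF st_y norm_y t01])
    let ?a = "sqrt t *\<^sub>R p"
    have "p * (p * q) = p * q * p" by (metis pq(4) mult.assoc)
    then have "(N ?a)\<^sup>2 \<le> N (?a * ?a + p * q * (p * q))"
      by (intro seminorm_real_part [OF N]) (simp_all add: st_scaleR st_mult pq)
    also have "?a * ?a + p * q * (p * q) = y * y * (p * p)"
      using that by (simp add: pq(5))
    also have "N \<dots> \<le> N (y * y) * N (p * p)" by (rule seminorm_mult [OF N])
    also have "\<dots> \<le> N (y * y) * (N p)\<^sup>2"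
      using seminorm_mult [OF N, of p p] seminorm_nonneg [OF N, of "y * y"]
      by (simp add: mult_left_mono power2_eq_square)
    finally have *: "(N ?a)\<^sup>2 \<le> N (y * y) * (N p)\<^sup>2" .
    have Np: "N p > 0" using inj [of p] pq(1) seminorm_nonneg [OF N, of p] by fastforce
    \<comment> \<open>\<open>seminorm_scaleR\<close> bounds only from above, so the lower bound
      comes from scaling back by \<open>1 / sqrt t\<close>; this excludes
      \<open>t = 0\<close>.\<close>
    have "t * (N p)\<^sup>2 \<le> (N ?a)\<^sup>2"
    proof (cases "t = 0")
      case False
      then have t: "t > 0" using that by simp
      have "N p \<le> (1 / sqrt t) * N ?a"
        using seminorm_scaleR [OF N, of "1 / sqrt t" ?a] t by simp
      then have "sqrt t * N p \<le> N ?a" using t by (simp add: field_simps)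
      then have "(sqrt t * N p)\<^sup>2 \<le> (N ?a)\<^sup>2"
        using t Np by (intro power_mono) simp_all
      then show ?thesis using t by (simp add: power_mult_distrib)
    qed simp
    then have "t * (N p)\<^sup>2 \<le> N (y * y) * (N p)\<^sup>2" using * by linarith
    then show ?thesis using Np by simp
  qed
  have "1 \<le> N (y * y)"
    by (rule dense_le_bounded [of 0]) (use bound in auto)
  also have "\<dots> \<le> (N y)\<^sup>2" using seminorm_mult [OF N, of y y] by (simp add: power2_eq_square)
  finally have "1 \<le> N y"
    using seminorm_nonneg [OF N, of y] by (metis one_power2 power2_le_imp_le)
  also have "N y \<le> (1 / s) * N (st a * a)"
    using seminorm_scaleR [OF N, of "1 / s" "st a * a"] s by (simp add: y_def)
  also have "\<dots> \<le> (1 / s) * (N a)\<^sup>2"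
  proof -
    have "N (st a * a) \<le> N (st a) * N a" by (rule seminorm_mult [OF N])
    also have "\<dots> \<le> N a * N a"
      by (intro mult_right_mono seminorm_st [OF N] seminorm_nonneg [OF N])
    finally show ?thesis using s by (simp add: power2_eq_square divide_right_mono)
  qed
  finally have "(norm a)\<^sup>2 \<le> (N a)\<^sup>2" using s by (simp add: field_simps s_def)
  then have "norm a \<le> N a"
    using seminorm_nonneg [OF N, of a] by (rule power2_le_imp_le)
  then show ?thesis using seminorm_le_norm [OF N, of a] by simp
qed

section \<open>Asymptotically central contractions\<close>

text \<open>Leibniz rule for the commutator with \<open>b\<close>; the surrounding powers of
  \<open>f\<close> are contractions.\<close>

lemma norm_commutator_power_le:
  fixes f b :: 'a
  assumes "norm f \<le> 1"
  shows "norm (f ^ k * b - b * f ^ k) \<le> real k * norm (f * b - b * f)"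
proof (induction k)
  case (Suc k)
  have fk: "norm (f ^ k) \<le> 1"
    by (rule order_trans [OF norm_power_ineq]) (simp add: power_le_one assms)
  have "f ^ Suc k * b - b * f ^ Suc k = f * (f ^ k * b - b * f ^ k) + (f * b - b * f) * f ^ k"
    by (simp add: algebra_simps)
  then have "norm (f ^ Suc k * b - b * f ^ Suc k)
      \<le> norm (f * (f ^ k * b - b * f ^ k)) + norm ((f * b - b * f) * f ^ k)"
    by (simp only: norm_triangle_ineq)
  also have "\<dots> \<le> 1 * norm (f ^ k * b - b * f ^ k) + norm (f * b - b * f) * 1"
    by (intro add_mono order_trans [OF norm_mult_ineq] mult_mono assms fk) simp_all
  also have "\<dots> \<le> real (Suc k) * norm (f * b - b * f)"
    using Suc by (simp add: algebra_simps)
  finally show ?case .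
qed simp

text \<open>The limsup is encoded by eventual strict upper bounds. Ranging over all powers
  \<open>k\<close> lets products and adjoint squares add up exponents, and \<open>0 \<le> c\<close>
  keeps the set bounded below even on the trivial filter.\<close>

definition asymp_seminorm :: "'a filter \<Rightarrow> 'a \<Rightarrow> real" where
  "asymp_seminorm \<Phi> b = Inf {c. 0 \<le> c \<and> (\<exists>k. \<forall>\<^sub>F f in \<Phi>. norm (f ^ k * b) < c)}"

lemma asymp_seminorm_le:
  assumes "0 \<le> c" "\<forall>\<^sub>F f in \<Phi>. norm (f ^ k * b) < c"
  shows "asymp_seminorm \<Phi> b \<le> c"
  unfolding asymp_seminorm_def
  by (rule cInf_lower) (use assms in \<open>auto intro!: bdd_belowI\<close>)

lemma asymp_seminorm_set_nonempty:
  fixes \<Phi> :: "'a filter" and b :: 'a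
  shows "{c. 0 \<le> c \<and> (\<exists>k. \<forall>\<^sub>F f in \<Phi>. norm (f ^ k * b) < c)} \<noteq> {}"
proof -
  have "norm b + 1 \<in> {c. 0 \<le> c \<and> (\<exists>k. \<forall>\<^sub>F f in \<Phi>. norm (f ^ k * b) < c)}"
    unfolding mem_Collect_eq by (intro conjI exI [of _ 0]) simp_all
  then show ?thesis by blast
qed

lemma asymp_seminorm_nonneg: "0 \<le> asymp_seminorm \<Phi> b"
  unfolding asymp_seminorm_def by (rule cInf_greatest [OF asymp_seminorm_set_nonempty]) auto

lemma asymp_seminorm_lessE:
  assumes "asymp_seminorm \<Phi> b < c"
  obtains k where "\<forall>\<^sub>F f in \<Phi>. norm (f ^ k * b) < c"
proof -
  obtain c' k where "c' < c" and ev: "\<forall>\<^sub>F f in \<Phi>. norm (f ^ k * b) < c'"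
    using cInf_lessD [OF asymp_seminorm_set_nonempty assms [unfolded asymp_seminorm_def]] by blast
  then have "\<forall>\<^sub>F f in \<Phi>. norm (f ^ k * b) < c"
    by (auto elim: eventually_mono)
  then show thesis by (rule that)
qed

definition asymp_central :: "'a filter \<Rightarrow> bool" where
  "asymp_central \<Phi> \<longleftrightarrow>
     (\<forall>\<^sub>F f in \<Phi>. st f = f \<and> norm f \<le> 1) \<and>
     (\<forall>b. ((\<lambda>f. norm (f * b - b * f)) \<longlongrightarrow> 0) \<Phi>) \<and> (norm \<longlongrightarrow> 1) \<Phi>"

context
  fixes \<Phi> :: "'a filter"
  assumes central: "asymp_central \<Phi>"
begin

lemma eventually_contraction: "\<forall>\<^sub>F f in \<Phi>. st f = f \<and> norm f \<le> 1"
  using central by (simp add: asymp_central_def)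

text \<open>The factor \<open>c\<close> makes room for the norm of an element multiplied onto the
  commutator.\<close>

lemma eventually_commutator_power:
  assumes "\<eta> > 0"
  shows "\<forall>\<^sub>F f in \<Phi>. norm (f ^ k * b - b * f ^ k) * c < \<eta>"
proof -
  have "((\<lambda>f. real k * norm (f * b - b * f) * \<bar>c\<bar>) \<longlongrightarrow> real k * 0 * \<bar>c\<bar>) \<Phi>"
    using central by (intro tendsto_intros) (simp add: asymp_central_def)
  then have "\<forall>\<^sub>F f in \<Phi>. real k * norm (f * b - b * f) * \<bar>c\<bar> < \<eta>"
    using assms by (intro order_tendstoD) simp_all
  with eventually_contraction show ?thesis
  proof eventually_elim
    case (elim f)
    have "norm (f ^ k * b - b * f ^ k) * c \<le> norm (f ^ k * b - b * f ^ k) * \<bar>c\<bar>"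
      by (intro mult_left_mono) simp_all
    also have "\<dots> \<le> real k * norm (f * b - b * f) * \<bar>c\<bar>"
      using elim by (intro mult_right_mono norm_commutator_power_le) simp_all
    finally show ?case using elim by simp
  qed
qed

text \<open>Further factors \<open>f\<close> are contractions, so exponents from different estimates
  can be replaced by a common larger one.\<close>

lemma eventually_power_mono:
  assumes "\<forall>\<^sub>F f in \<Phi>. norm (f ^ k * b) < c" "k \<le> l"
  shows "\<forall>\<^sub>F f in \<Phi>. norm (f ^ l * b) < c"
  using assms(1) eventually_contraction
proof eventually_elim
  case (elim f)
  have "norm (f ^ l * b) = norm (f ^ (l - k) * (f ^ k * b))"
    using assms(2) by (simp add: mult.assoc [symmetric] power_add [symmetric])
  also have "\<dots> \<le> norm (f ^ (l - k)) * norm (f ^ k * b)" by (rule norm_mult_ineq)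
  also have "\<dots> \<le> 1 * norm (f ^ k * b)"
    using elim
    by (intro mult_right_mono order_trans [OF norm_power_ineq]) (simp_all add: power_le_one)
  finally show ?case using elim by simp
qed

lemma asymp_seminorm_le_norm: "asymp_seminorm \<Phi> b \<le> norm b"
proof (rule field_le_epsilon)
  fix e :: real assume "e > 0"
  then show "asymp_seminorm \<Phi> b \<le> norm b + e"
    by (intro asymp_seminorm_le [where k = 0]) simp_all
qed

lemma asymp_seminorm_add:
  "asymp_seminorm \<Phi> (b + c) \<le> asymp_seminorm \<Phi> b + asymp_seminorm \<Phi> c"
proof (rule field_le_epsilon)
  fix e :: real assume e: "e > 0"
  obtain k where k: "\<forall>\<^sub>F f in \<Phi>. norm (f ^ k * b) < asymp_seminorm \<Phi> b + e / 2"
    using asymp_seminorm_lessE [of \<Phi> b "asymp_seminorm \<Phi> b + e / 2"] e by auto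
  obtain l where l: "\<forall>\<^sub>F f in \<Phi>. norm (f ^ l * c) < asymp_seminorm \<Phi> c + e / 2"
    using asymp_seminorm_lessE [of \<Phi> c "asymp_seminorm \<Phi> c + e / 2"] e by auto
  have "\<forall>\<^sub>F f in \<Phi>. norm (f ^ max k l * (b + c)) < asymp_seminorm \<Phi> b + asymp_seminorm \<Phi> c + e"
    using eventually_power_mono [OF k max.cobounded1 [of k l]] eventually_power_mono [OF l max.cobounded2 [of l k]]
  proof eventually_elim
    case (elim f)
    then show ?case
      using norm_triangle_ineq [of "f ^ max k l * b" "f ^ max k l * c"]
      unfolding distrib_left by linarith
  qed
  then show "asymp_seminorm \<Phi> (b + c) \<le> asymp_seminorm \<Phi> b + asymp_seminorm \<Phi> c + e"
    using asymp_seminorm_nonneg [of \<Phi> b] asymp_seminorm_nonneg [of \<Phi> c] e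
    by (intro asymp_seminorm_le) simp_all
qed

text \<open>Of the \<open>k + l\<close> factors \<open>f\<close>, move \<open>l\<close> past
  \<open>b\<close> to reach \<open>(f^k * b) * (f^l * c)\<close>; the commutator error vanishes
  along the filter.\<close>

lemma asymp_seminorm_mult_less:
  assumes "asymp_seminorm \<Phi> b < s" "asymp_seminorm \<Phi> c < t"
  shows "asymp_seminorm \<Phi> (b * c) \<le> s * t"
proof (rule field_le_epsilon)
  fix e :: real assume e: "e > 0"
  obtain k where k: "\<forall>\<^sub>F f in \<Phi>. norm (f ^ k * b) < s"
    using asymp_seminorm_lessE [OF assms(1)] .
  obtain l where l: "\<forall>\<^sub>F f in \<Phi>. norm (f ^ l * c) < t"
    using asymp_seminorm_lessE [OF assms(2)] .
  have pos: "0 \<le> s" "0 \<le> t"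
    using assms asymp_seminorm_nonneg [of \<Phi> b] asymp_seminorm_nonneg [of \<Phi> c] by linarith+
  have "\<forall>\<^sub>F f in \<Phi>. norm (f ^ (k + l) * (b * c)) < s * t + e"
    using k l eventually_contraction eventually_commutator_power [OF e, of l b "norm c"]
  proof eventually_elim
    case (elim f)
    have fk: "norm (f ^ k) \<le> 1"
      using elim by (intro order_trans [OF norm_power_ineq]) (simp add: power_le_one)
    have "f ^ (k + l) * (b * c)
        = f ^ k * ((f ^ l * b - b * f ^ l) * c) + (f ^ k * b) * (f ^ l * c)"
      by (simp add: algebra_simps power_add)
    then have "norm (f ^ (k + l) * (b * c))
        \<le> norm (f ^ k * ((f ^ l * b - b * f ^ l) * c)) + norm ((f ^ k * b) * (f ^ l * c))"
      by (simp only: norm_triangle_ineq)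
    moreover have "norm (f ^ k * ((f ^ l * b - b * f ^ l) * c))
        \<le> 1 * (norm (f ^ l * b - b * f ^ l) * norm c)"
      by (rule order_trans [OF norm_mult_ineq]) (intro mult_mono fk norm_mult_ineq, simp_all)
    moreover have "norm ((f ^ k * b) * (f ^ l * c)) \<le> s * t"
      by (rule order_trans [OF norm_mult_ineq]) (intro mult_mono; use elim pos in simp)
    ultimately show ?case using elim by simp
  qed
  then show "asymp_seminorm \<Phi> (b * c) \<le> s * t + e"
    using pos e by (intro asymp_seminorm_le) simp_all
qed

lemma asymp_seminorm_mult:
  "asymp_seminorm \<Phi> (b * c) \<le> asymp_seminorm \<Phi> b * asymp_seminorm \<Phi> c"
proof -
  have "((\<lambda>e. (asymp_seminorm \<Phi> b + e) * (asymp_seminorm \<Phi> c + e))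
      \<longlongrightarrow> (asymp_seminorm \<Phi> b + 0) * (asymp_seminorm \<Phi> c + 0)) (at_right 0)"
    by (intro tendsto_intros)
  moreover have "\<forall>\<^sub>F e in at_right 0.
      asymp_seminorm \<Phi> (b * c) \<le> (asymp_seminorm \<Phi> b + e) * (asymp_seminorm \<Phi> c + e)"
    using eventually_at_right_less [of "0::real"]
    by eventually_elim (intro asymp_seminorm_mult_less, simp_all)
  ultimately show ?thesis
    using tendsto_lowerbound [OF _ _ trivial_limit_at_right_real] by fastforce
qed

text \<open>The C*-identity for \<open>f^k * b\<close> involves \<open>st b * f^(2k) * b\<close>,
  and asymptotic centrality moves the power to the front.\<close>

lemma asymp_seminorm_cstar: "(asymp_seminorm \<Phi> b)\<^sup>2 \<le> asymp_seminorm \<Phi> (st b * b)"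
proof (rule field_le_epsilon)
  fix e :: real assume e: "e > 0"
  define c where "c = asymp_seminorm \<Phi> (st b * b) + e"
  have c: "c > 0" using asymp_seminorm_nonneg [of \<Phi> "st b * b"] e by (simp add: c_def)
  \<comment> \<open>Half of the slack \<open>e\<close> goes to this bound, the other half to the
    commutator.\<close>
  obtain k where k: "\<forall>\<^sub>F f in \<Phi>. norm (f ^ k * (st b * b)) < c - e / 2"
    using asymp_seminorm_lessE [of \<Phi> "st b * b" "c - e / 2"] e by (auto simp: c_def)
  have "\<forall>\<^sub>F f in \<Phi>. norm (f ^ k * b) < sqrt c"
    using k eventually_contraction
      eventually_commutator_power [OF half_gt_zero [OF e], of "k + k" "st b" "norm b"]
  proof eventually_elim
    case (elim f)
    have fk: "norm (f ^ k) \<le> 1"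
      using elim by (intro order_trans [OF norm_power_ineq]) (simp add: power_le_one)
    let ?d = "f ^ (k + k) * st b - st b * f ^ (k + k)"
    have "st (f ^ k * b) * (f ^ k * b) = f ^ k * (f ^ k * (st b * b)) - ?d * b"
      using elim by (simp add: st_mult st_power algebra_simps power_add)
    then have "(norm (f ^ k * b))\<^sup>2 = norm (f ^ k * (f ^ k * (st b * b)) - ?d * b)"
      by (metis norm_st_mult_self)
    also have "\<dots> \<le> norm (f ^ k * (f ^ k * (st b * b))) + norm (?d * b)"
      by (rule norm_triangle_ineq4)
    also have "\<dots> \<le> norm (f ^ k) * norm (f ^ k * (st b * b)) + norm ?d * norm b"
      by (intro add_mono norm_mult_ineq)
    also have "\<dots> \<le> 1 * norm (f ^ k * (st b * b)) + norm ?d * norm b"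
      by (intro add_mono mult_right_mono fk) simp_all
    also have "\<dots> < c" using elim by simp
    finally show ?case by (rule real_less_rsqrt)
  qed
  then have "asymp_seminorm \<Phi> b \<le> sqrt c"
    using c by (intro asymp_seminorm_le) simp_all
  then have "(asymp_seminorm \<Phi> b)\<^sup>2 \<le> (sqrt c)\<^sup>2"
    by (intro power_mono asymp_seminorm_nonneg)
  then show "(asymp_seminorm \<Phi> b)\<^sup>2 \<le> asymp_seminorm \<Phi> (st b * b) + e"
    using c by (simp add: c_def)
qed

lemma cstar_seminorm_asymp: "cstar_seminorm (asymp_seminorm \<Phi>)"
  unfolding cstar_seminorm_def
  by (intro conjI allI asymp_seminorm_nonneg asymp_seminorm_le_norm asymp_seminorm_add
      asymp_seminorm_mult asymp_seminorm_cstar)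

text \<open>For fixed \<open>k\<close>, raise the exponent to \<open>2^k\<close>: there the norm of
  the power is the power of the norm, which tends to 1.\<close>

lemma asymp_seminorm_one:
  assumes "\<Phi> \<noteq> bot"
  shows "1 \<le> asymp_seminorm \<Phi> 1"
proof (rule ccontr)
  assume "\<not> 1 \<le> asymp_seminorm \<Phi> 1"
  then obtain c where c: "asymp_seminorm \<Phi> 1 < c" "c < 1"
    using dense [of "asymp_seminorm \<Phi> 1" 1] by auto
  obtain k where k: "\<forall>\<^sub>F f in \<Phi>. norm (f ^ k * 1) < c"
    using asymp_seminorm_lessE [OF c(1)] .
  have "((\<lambda>f. norm f ^ (2 ^ k)) \<longlongrightarrow> 1 ^ (2 ^ k)) \<Phi>"
    using central by (intro tendsto_intros) (simp add: asymp_central_def)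
  then have "\<forall>\<^sub>F f in \<Phi>. c < norm f ^ (2 ^ k)"
    using c by (intro order_tendstoD) simp_all
  with eventually_power_mono [OF k less_imp_le [OF less_exp]] eventually_contraction
  have "\<forall>\<^sub>F f in \<Phi>. False"
    by eventually_elim (auto simp: norm_selfadjoint_power less_imp_le)
  then show False using assms by simp
qed

end

section \<open>Norms of compressions in simple algebras\<close>

lemma asymp_central_mono:
  assumes "asymp_central \<Phi>" "\<Psi> \<le> \<Phi>"
  shows "asymp_central \<Psi>"
  using assms(1) filter_leD [OF assms(2)] tendsto_mono [OF assms(2)]
  unfolding asymp_central_def by blast

text \<open>Submultiplicativity gives the ideal property; domination by the norm makes
  \<open>N\<close> 1-Lipschitz, hence its null set closed.\<close>

lemma seminorm_null_ideal:
  assumes N: "cstar_seminorm N"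
  shows "cstar_ideal sc {x. N x = 0}" "closed {x. N x = 0}"
proof -
  have eq0: "N x = 0 \<longleftrightarrow> N x \<le> 0" for x
    using seminorm_nonneg [OF N, of x] by auto
  have "N 0 = 0" using seminorm_le_norm [OF N, of 0] by (simp add: eq0)
  moreover have "N (x + y) = 0" if "N x = 0" "N y = 0" for x y
    using seminorm_add [OF N, of x y] that by (simp add: eq0)
  moreover have "N (sc c x) = 0" if "N x = 0" for c x
    using seminorm_sc [OF N, of c x] that by (simp add: eq0)
  moreover have "N (a * x) = 0 \<and> N (x * a) = 0" if "N x = 0" for a x
    using seminorm_mult [OF N, of a x] seminorm_mult [OF N, of x a] that by (simp add: eq0)
  ultimately show "cstar_ideal sc {x. N x = 0}"
    unfolding cstar_ideal_def by blast
  have "N x \<le> N y + dist x y" for x y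
    using seminorm_add [OF N, of y "x - y"] seminorm_le_norm [OF N, of "x - y"]
    by (simp add: dist_norm)
  then have "dist (N x) (N y) \<le> dist x y" for x y
    by (smt (verit) dist_commute dist_real_def)
  then have "continuous_on UNIV N"
    unfolding continuous_on_def
    by (intro ballI metric_tendsto_imp_tendsto [OF tendsto_ident_at] always_eventually) simp
  then show "closed {x. N x = 0}"
    by (intro closed_Collect_eq continuous_on_const)
qed

lemma eventually_norm_compress_gt:
  assumes simple: "simple_unital_cstar_algebra st sc"
    and central: "asymp_central \<Phi>" and "\<epsilon> > 0"
  shows "\<forall>\<^sub>F f in \<Phi>. norm (f * a * f) > norm a - \<epsilon>"
proof (rule ccontr)
  assume neg: "\<not> ?thesis"
  \<comment> \<open>The trace of the filter on the offending \<open>f\<close>, nontrivial exactly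
    because the claim fails. Its seminorm must equal the norm, although all its elements compress
    \<open>a\<close> too much.\<close>
  define \<Psi> where "\<Psi> = inf \<Phi> (principal {f. \<not> norm (f * a * f) > norm a - \<epsilon>})"
  have \<Psi>: "\<Psi> \<noteq> bot"
    using neg by (simp add: \<Psi>_def trivial_limit_def eventually_inf_principal)
  have central_\<Psi>: "asymp_central \<Psi>"
    by (rule asymp_central_mono [OF central]) (simp add: \<Psi>_def)
  let ?N = "asymp_seminorm \<Psi>"
  note N = cstar_seminorm_asymp [OF central_\<Psi>]
  have "{x. ?N x = 0} = {0} \<or> {x. ?N x = 0} = UNIV"
    using simple seminorm_null_ideal [OF N] unfolding simple_unital_cstar_algebra_def by blast
  moreover have "?N 1 \<noteq> 0" using asymp_seminorm_one [OF central_\<Psi> \<Psi>] by linarith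
  ultimately have "{x. ?N x = 0} = {0}" by blast
  then have norm_a: "?N a = norm a" by (intro cstar_norm_unique [OF N]) blast
  have "\<forall>\<^sub>F f in \<Psi>. norm (f * a * f) \<le> norm a - \<epsilon>"
    by (simp add: \<Psi>_def eventually_inf_principal)
  with eventually_contraction [OF central_\<Psi>]
    eventually_commutator_power [OF central_\<Psi> half_gt_zero [OF \<open>\<epsilon> > 0\<close>], of 1 a 1]
  have ev: "\<forall>\<^sub>F f in \<Psi>. norm (f ^ 2 * a) < norm a - \<epsilon> / 2"
  proof eventually_elim
    case (elim f)
    have "f ^ 2 * a = f * a * f + f * (f * a - a * f)"
      by (simp add: algebra_simps power2_eq_square)
    then have "norm (f ^ 2 * a) \<le> norm (f * a * f) + norm (f * (f * a - a * f))"
      by (simp only: norm_triangle_ineq)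
    also have "norm (f * (f * a - a * f)) \<le> 1 * norm (f * a - a * f)"
      using elim by (intro order_trans [OF norm_mult_ineq] mult_right_mono) simp_all
    finally show ?case using elim by simp
  qed
  \<comment> \<open>A single witness shows that the bound is nonnegative, as
    \<open>asymp_seminorm_le\<close> demands.\<close>
  then have "\<exists>f. norm (f ^ 2 * a) < norm a - \<epsilon> / 2"
    using \<Psi> eventually_happens' by blast
  then have "0 \<le> norm a - \<epsilon> / 2"
    by (meson norm_ge_zero le_less_trans less_imp_le)
  then have "?N a \<le> norm a - \<epsilon> / 2" by (rule asymp_seminorm_le [OF _ ev])
  then show False using norm_a \<open>\<epsilon> > 0\<close> by simp
qed

text \<open>Pairs of a finite set and a tolerance index a base of a filter that is asymptotically
  central by construction. What holds eventually along it already holds on one member of the base,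
  which supplies \<open>F'\<close> and \<open>\<delta>\<close>.\<close>

lemma uniform_norm_compress_gt:
  assumes simple: "simple_unital_cstar_algebra st sc" and "finite F" "\<epsilon> > 0"
  obtains F' \<delta> where "finite F'" "\<delta> > 0"
    "\<And>f. \<lbrakk>st f = f; norm f \<le> 1; \<forall>b\<in>F'. norm (f * b - b * f) < \<delta>; norm f > 1 - \<delta>\<rbrakk>
      \<Longrightarrow> \<forall>a\<in>F. norm (f * a * f) > norm a - \<epsilon>"
proof -
  define S where "S = (\<lambda>(F', \<delta>). {f. st f = f \<and> norm f \<le> 1 \<and>
    (\<forall>b\<in>F'. norm (f * b - b * f) < \<delta>) \<and> norm f > 1 - \<delta>})"
  define B where "B = {F' :: 'a set. finite F'} \<times> {0 :: real <..}"
  define \<Phi> where "\<Phi> = (INF i\<in>B. principal (S i))"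
  have ev: "eventually P \<Phi>" if "finite F'" "\<delta> > 0" "\<forall>f\<in>S (F', \<delta>). P f" for P F' \<delta>
  proof (rule filter_leD)
    show "\<Phi> \<le> principal (S (F', \<delta>))"
      unfolding \<Phi>_def by (rule INF_lower) (simp add: B_def that)
    show "eventually P (principal (S (F', \<delta>)))"
      using that by (simp add: eventually_principal)
  qed
  have "asymp_central \<Phi>"
    unfolding asymp_central_def
  proof (intro conjI allI)
    show "\<forall>\<^sub>F f in \<Phi>. st f = f \<and> norm f \<le> 1"
      by (rule ev [of "{}" 1]) (auto simp: S_def)
    show "((\<lambda>f. norm (f * b - b * f)) \<longlongrightarrow> 0) \<Phi>" for b
    proof (rule tendstoI)
      fix e :: real assume "e > 0"
      then show "\<forall>\<^sub>F f in \<Phi>. dist (norm (f * b - b * f)) 0 < e"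
        by (intro ev [of "{b}" e]) (auto simp: S_def)
    qed
    show "(norm \<longlongrightarrow> 1) \<Phi>"
    proof (rule tendstoI)
      fix e :: real assume "e > 0"
      then show "\<forall>\<^sub>F f in \<Phi>. dist (norm f) 1 < e"
        by (intro ev [of "{}" e]) (auto simp: S_def dist_real_def)
    qed
  qed
  then have "\<forall>\<^sub>F f in \<Phi>. \<forall>a\<in>F. norm (f * a * f) > norm a - \<epsilon>"
    using assms by (intro eventually_ball_finite ballI eventually_norm_compress_gt) auto
  also have "eventually P \<Phi> \<longleftrightarrow> (\<exists>i\<in>B. eventually P (principal (S i)))" for P
    unfolding \<Phi>_def
  proof (rule eventually_INF_base)
    show "B \<noteq> {}" by (auto simp: B_def intro: exI [of _ "{}"] exI [of _ 1])
    fix i j assume ij: "i \<in> B" "j \<in> B"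
    then show "\<exists>l\<in>B. principal (S l) \<le> inf (principal (S i)) (principal (S j))"
      by (intro bexI [of _ "(fst i \<union> fst j, min (snd i) (snd j))"]) (auto simp: S_def B_def)
  qed
  finally obtain i where i: "i \<in> B" "\<forall>f\<in>S i. \<forall>a\<in>F. norm (f * a * f) > norm a - \<epsilon>"
    by (auto simp: eventually_principal)
  obtain F' \<delta> where "i = (F', \<delta>)" by (cases i)
  with i show thesis by (intro that [of F' \<delta>]) (auto simp: B_def S_def)
qed

section \<open>Rokhlin towers\<close>

lemma positive_selfadjoint: "positive st a \<Longrightarrow> st a = a"
  by (auto simp: positive_def st_mult)

lemma projection_norm_le: "projection st p \<Longrightarrow> norm p \<le> 1"
  using norm_st_mult_self [of p] by (auto simp: projection_def power2_eq_square)

text \<open>All mixed products vanish. The exponent is a successor since at exponent 0 the right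
  side would add up one unit per index.\<close>

lemma power_sum_orthogonal:
  fixes f :: "'i \<Rightarrow> 'a"
  assumes "finite I" and orth: "\<And>i j. \<lbrakk>i \<in> I; j \<in> I; i \<noteq> j\<rbrakk> \<Longrightarrow> f i * f j = 0"
  shows "(\<Sum>i\<in>I. f i) ^ Suc n = (\<Sum>i\<in>I. f i ^ Suc n)"
proof (induction n)
  case (Suc n)
  have prod: "f i * f j ^ Suc n = (if j = i then f i ^ Suc (Suc n) else 0)" if "i \<in> I" "j \<in> I" for i j
    using orth [of i j] that by (auto simp: mult.assoc [symmetric])
  then have "(\<Sum>i\<in>I. \<Sum>j\<in>I. f i * f j ^ Suc n) = (\<Sum>i\<in>I. f i ^ Suc (Suc n))"
    using assms(1) by (simp add: prod cong: sum.cong_simp del: power_Suc)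
  then show ?case
    by (subst power_Suc) (simp only: Suc sum_product)
qed simp

text \<open>Since \<open>f\<close> is self-adjoint, its norm to the power \<open>2^m\<close> is the norm of \<open>f^(2^m)\<close>, which is at
  most the number of summands, for every \<open>m\<close>.\<close>
lemma norm_sum_orthogonal_le:
  fixes f :: "'i \<Rightarrow> 'a"
  assumes "finite I" and orth: "\<And>i j. \<lbrakk>i \<in> I; j \<in> I; i \<noteq> j\<rbrakk> \<Longrightarrow> f i * f j = 0"
    and sa: "\<And>i. i \<in> I \<Longrightarrow> st (f i) = f i" and le: "\<And>i. i \<in> I \<Longrightarrow> norm (f i) \<le> 1"
  shows "norm (\<Sum>i\<in>I. f i) \<le> 1"
proof (rule ccontr)
  let ?s = "\<Sum>i\<in>I. f i"
  assume "\<not> norm ?s \<le> 1"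
  then have gt: "norm ?s > 1" by simp
  obtain m where m: "real (card I) < norm ?s ^ m"
    using real_arch_pow [OF gt] by blast
  have st_s: "st ?s = ?s" by (simp add: st_sum sa)
  obtain n where n: "2 ^ m = Suc n" by (metis not0_implies_Suc power_not_zero zero_neq_numeral)
  have "norm ?s ^ m \<le> norm ?s ^ (2 ^ m)"
    using gt by (intro power_increasing) (simp_all add: less_imp_le)
  also have "\<dots> = norm (?s ^ (2 ^ m))" by (simp add: norm_selfadjoint_power st_s)
  also have "\<dots> = norm (\<Sum>i\<in>I. f i ^ Suc n)"
    unfolding n by (subst power_sum_orthogonal [OF assms(1) orth]) simp_all
  also have "\<dots> \<le> (\<Sum>i\<in>I. 1)"
  proof (rule sum_norm_le)
    fix i assume "i \<in> I"
    then show "norm (f i ^ Suc n) \<le> 1"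
      by (intro order_trans [OF norm_power_ineq] power_le_one le) simp_all
  qed
  finally show False using m by simp
qed

section \<open>Implications between the three conditions\<close>

lemma cuntz_below_scaleR:
  assumes "cuntz_below st a (r *\<^sub>R b)" "r \<ge> 0"
  shows "cuntz_below st a b"
proof -
  obtain v where v: "(\<lambda>n. v n * (r *\<^sub>R b) * st (v n)) \<longlonglongrightarrow> a"
    using assms by (auto simp: cuntz_below_def)
  have "(sqrt r *\<^sub>R v n) * b * st (sqrt r *\<^sub>R v n) = v n * (r *\<^sub>R b) * st (v n)" for n
    using assms(2) by (simp add: st_scaleR)
  then show ?thesis
    unfolding cuntz_below_def using v by (intro exI [of _ "\<lambda>n. sqrt r *\<^sub>R v n"]) simp
qed

lemma positive_scaleR: "positive st b \<Longrightarrow> r \<ge> 0 \<Longrightarrow> positive st (r *\<^sub>R b)"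
  unfolding positive_def
  by (elim exE, rule exI [of _ "sqrt r *\<^sub>R _"]) (auto simp: st_scaleR)

text \<open>Normalise \<open>x\<close>; the scalar is absorbed into the sequence witnessing Cuntz
  subequivalence. Then \<open>norm (f * x * f)\<close> is at most the square of
  \<open>norm f\<close>, which would be at most \<open>1 - \<epsilon>\<close> if
  \<open>norm f\<close> were.\<close>

lemma rokhlin_type_imp_cond2:
  assumes "rokhlin_type_property G st \<alpha> P"
  shows "rokhlin_cond2 G st \<alpha> P"
  unfolding rokhlin_cond2_def
proof (intro allI impI)
  fix F :: "'a set" and \<epsilon> :: real and x assume *: "finite F \<and> 0 < \<epsilon> \<and> positive st x \<and> x \<noteq> 0"
  let ?x = "(1 / norm x) *\<^sub>R x"
  have "positive st ?x" "norm ?x = 1" using * by (simp_all add: positive_scaleR)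
  then obtain f where f: "rokhlin_tower G st \<alpha> P F \<epsilon> ?x f"
    and gt: "norm ((\<Sum>g\<in>carrier G. f g) * ?x * (\<Sum>g\<in>carrier G. f g)) > 1 - \<epsilon>"
    using assms * unfolding rokhlin_type_property_def by blast
  let ?f = "\<Sum>g\<in>carrier G. f g"
  have "rokhlin_tower G st \<alpha> P F \<epsilon> x f"
    using f * cuntz_below_scaleR [of _ "1 / norm x" x] by (simp add: rokhlin_tower_def)
  moreover have "norm ?f > 1 - \<epsilon>"
  proof (rule ccontr)
    assume neg: "\<not> norm ?f > 1 - \<epsilon>"
    then have \<epsilon>: "0 \<le> 1 - \<epsilon>" using norm_ge_zero [of ?f] by linarith
    have "norm (?f * ?x * ?f) \<le> norm ?f * norm ?x * norm ?f"
      by (intro order_trans [OF norm_mult_ineq] mult_right_mono norm_mult_ineq) simp_all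
    also have "\<dots> = norm ?f * norm ?f" using \<open>norm ?x = 1\<close> by simp
    also have "\<dots> \<le> (1 - \<epsilon>) * 1"
      using neg \<epsilon> * by (intro mult_mono) simp_all
    finally show False using gt by simp
  qed
  ultimately show "\<exists>f. rokhlin_tower G st \<alpha> P F \<epsilon> x f \<and> norm (\<Sum>g\<in>carrier G. f g) > 1 - \<epsilon>"
    by blast
qed

text \<open>Add \<open>x\<close>, of norm 1, to the finite set.\<close>

lemma rokhlin_cond3_imp_type:
  assumes "rokhlin_cond3 G st \<alpha> P"
  shows "rokhlin_type_property G st \<alpha> P"
  unfolding rokhlin_type_property_def
proof (intro allI impI)
  fix F :: "'a set" and \<epsilon> :: real and x assume *: "finite F \<and> 0 < \<epsilon> \<and> positive st x \<and> norm x = 1"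
  then have "finite (insert x F) \<and> 0 < \<epsilon> \<and> positive st x \<and> x \<noteq> 0" by auto
  then obtain f where f: "rokhlin_tower G st \<alpha> P (insert x F) \<epsilon> x f"
    and gt: "\<forall>a\<in>insert x F.
      norm ((\<Sum>g\<in>carrier G. f g) * a * (\<Sum>g\<in>carrier G. f g)) > norm a - \<epsilon>"
    using assms unfolding rokhlin_cond3_def by blast
  from f have "rokhlin_tower G st \<alpha> P F \<epsilon> x f" by (simp add: rokhlin_tower_def)
  moreover from gt have "norm ((\<Sum>g\<in>carrier G. f g) * x * (\<Sum>g\<in>carrier G. f g)) > 1 - \<epsilon>"
    using * by auto
  ultimately show "\<exists>f. rokhlin_tower G st \<alpha> P F \<epsilon> x f \<and>
      norm ((\<Sum>g\<in>carrier G. f g) * x * (\<Sum>g\<in>carrier G. f g)) > 1 - \<epsilon>" by blast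
qed

text \<open>The sum of a tower is a self-adjoint contraction by orthogonality, and its commutators
  are at most the group order times those of the summands. A fine enough tower therefore satisfies
  the hypotheses of \<open>uniform_norm_compress_gt\<close>.\<close>

lemma rokhlin_cond2_imp_cond3:
  assumes simple: "simple_unital_cstar_algebra st sc" and "finite (carrier G)"
    and P: "\<And>a. P a \<Longrightarrow> st a = a \<and> norm a \<le> 1"
    and cond2: "rokhlin_cond2 G st \<alpha> P"
  shows "rokhlin_cond3 G st \<alpha> P"
  unfolding rokhlin_cond3_def
proof (intro allI impI)
  fix F :: "'a set" and \<epsilon> :: real and x assume *: "finite F \<and> 0 < \<epsilon> \<and> positive st x \<and> x \<noteq> 0"
  then obtain F' \<delta> where F': "finite F'" "\<delta> > 0"
    and compress: "\<And>f. \<lbrakk>st f = f; norm f \<le> 1; \<forall>b\<in>F'. norm (f * b - b * f) < \<delta>; norm f > 1 - \<delta>\<rbrakk>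
      \<Longrightarrow> \<forall>a\<in>F. norm (f * a * f) > norm a - \<epsilon>"
    using uniform_norm_compress_gt [OF simple, of F \<epsilon>] by blast
  \<comment> \<open>The extra 1 keeps \<open>n\<close> at least 1 and makes the estimate of the
    summed commutators strict.\<close>
  define n where "n = real (card (carrier G)) + 1"
  have n: "n \<ge> 1" by (simp add: n_def)
  \<comment> \<open>\<open>\<epsilon>\<close> serves the tower conditions on \<open>F\<close>, and
    \<open>\<delta> / n\<close> the commutators of the sum with \<open>F'\<close>.\<close>
  define \<eta> where "\<eta> = min \<epsilon> (\<delta> / n)"
  have "\<delta> / n \<le> \<delta> / 1" using F' n by (intro divide_left_mono) simp_all
  then have \<eta>: "0 < \<eta>" "\<eta> \<le> \<epsilon>" "\<eta> \<le> \<delta> / n" "\<eta> \<le> \<delta>"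
    using * F' n by (simp_all add: \<eta>_def min_le_iff_disj)
  have "finite (F \<union> F') \<and> 0 < \<eta> \<and> positive st x \<and> x \<noteq> 0" using * F' \<eta> by simp
  then obtain f where f: "rokhlin_tower G st \<alpha> P (F \<union> F') \<eta> x f"
    and gt: "norm (\<Sum>g\<in>carrier G. f g) > 1 - \<eta>"
    using cond2 unfolding rokhlin_cond2_def by blast
  let ?f = "\<Sum>g\<in>carrier G. f g"
  have Pf: "st (f g) = f g" "norm (f g) \<le> 1" if "g \<in> carrier G" for g
    using f P that by (auto simp: rokhlin_tower_def)
  have "rokhlin_tower G st \<alpha> P F \<epsilon> x f"
    using f less_le_trans [OF _ \<eta>(2)] unfolding rokhlin_tower_def by blast
  moreover have "\<forall>a\<in>F. norm (?f * a * ?f) > norm a - \<epsilon>"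
  proof (rule compress)
    show "st ?f = ?f" by (simp add: st_sum Pf)
    show "norm ?f \<le> 1"
      using f by (intro norm_sum_orthogonal_le assms(2) Pf) (auto simp: rokhlin_tower_def)
    show "norm ?f > 1 - \<delta>" using gt \<eta> by simp
    show "\<forall>b\<in>F'. norm (?f * b - b * ?f) < \<delta>"
    proof
      fix b assume b: "b \<in> F'"
      have "norm (?f * b - b * ?f) = norm (\<Sum>g\<in>carrier G. f g * b - b * f g)"
        by (simp add: sum_distrib_left sum_distrib_right sum_subtractf)
      also have "\<dots> \<le> (\<Sum>g\<in>carrier G. \<eta>)"
        using f b by (intro sum_norm_le) (auto simp: rokhlin_tower_def less_imp_le)
      also have "\<dots> < n * \<eta>" using \<eta>(1) by (simp add: n_def algebra_simps)
      also have "\<dots> \<le> \<delta>" using \<eta>(3) n by (simp add: field_simps)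
      finally show "norm (?f * b - b * ?f) < \<delta>" .
    qed
  qed
  ultimately show "\<exists>f. rokhlin_tower G st \<alpha> P F \<epsilon> x f \<and>
      (\<forall>a\<in>F. norm ((\<Sum>g\<in>carrier G. f g) * a * (\<Sum>g\<in>carrier G. f g)) > norm a - \<epsilon>)" by blast
qed

end

theorem theorem1p1:
  fixes G :: "('g, 'b) monoid_scheme"
    and st :: "'a::{real_normed_algebra_1,banach} \<Rightarrow> 'a"
    and sc :: "complex \<Rightarrow> 'a \<Rightarrow> 'a"
    and \<alpha> :: "'g \<Rightarrow> 'a \<Rightarrow> 'a"
  assumes "simple_unital_cstar_algebra st sc"
    and "group G" and "finite (carrier G)"
    and "group_action_cstar G st sc \<alpha>"
  shows "(weak_tracial_rokhlin G st \<alpha> \<longleftrightarrow> rokhlin_cond2 G st \<alpha> (pos_contraction st)) \<and>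
         (weak_tracial_rokhlin G st \<alpha> \<longleftrightarrow> rokhlin_cond3 G st \<alpha> (pos_contraction st)) \<and>
         (tracial_rokhlin G st \<alpha> \<longleftrightarrow> rokhlin_cond2 G st \<alpha> (projection st)) \<and>
         (tracial_rokhlin G st \<alpha> \<longleftrightarrow> rokhlin_cond3 G st \<alpha> (projection st))"
proof -
  interpret cstar st sc
    using assms(1) by unfold_locales (simp add: simple_unital_cstar_algebra_def)
  \<comment> \<open>This common feature of the two kinds of elements allows both versions of the
    theorem to be proved at once.\<close>
  have contraction: "st a = a \<and> norm a \<le> 1" if "pos_contraction st a \<or> projection st a" for a
    using that positive_selfadjoint projection_norm_le
    by (auto simp: pos_contraction_def projection_def)
  have equiv: "(rokhlin_type_property G st \<alpha> P \<longleftrightarrow> rokhlin_cond2 G st \<alpha> P) \<and>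
      (rokhlin_type_property G st \<alpha> P \<longleftrightarrow> rokhlin_cond3 G st \<alpha> P)"
    if P: "\<And>a. P a \<Longrightarrow> pos_contraction st a \<or> projection st a" for P
  proof -
    \<comment> \<open>This closes the cycle from the Rokhlin-type property through the second and
      third conditions.\<close>
    have "rokhlin_cond2 G st \<alpha> P \<Longrightarrow> rokhlin_cond3 G st \<alpha> P"
      by (rule rokhlin_cond2_imp_cond3 [OF assms(1,3)]) (use contraction P in blast)
    with rokhlin_type_imp_cond2 [of G \<alpha> P] rokhlin_cond3_imp_type [of G \<alpha> P]
    show ?thesis by argo
  qed
  show ?thesis
    unfolding weak_tracial_rokhlin_def tracial_rokhlin_def
    using equiv [OF disjI1] equiv [OF disjI2] by (intro conjI) blast+
qed

end
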